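(* Let $I$ be a monomial ideal in a polynomial ring $R$ over a field. Suppose that for any subsets $\sigma,\tau$ of $\mathcal G(I)$, $\operatorname{lcm}(\sigma)=\operatorname{lcm}(\tau)$ implies $\operatorname{lcm}(\sigma)=\operatorname{lcm}(\sigma\cap\tau)$. Then $I$ is bridge-friendly. In particular, its minimal Barile-Macchia resolution is exactly its Scarf complex.
   Context: Let $R=\Bbbk[x_1,\dots,x_N]$, $I\subseteq R$ a monomial ideal with minimal monomial generating set $\mathcal G(I)$, and $>_I$ a total ordering on $\mathcal G(I)$; $\operatorname{lcm}(\emptyset)=1$. The Taylor resolution $\mathcal F$ of $R/I$ has $\mathcal F_r$ free on the subsets of $\mathcal G(I)$ of cardinality $r$, with $\partial(\sigma)=\sum_{\sigma'\subseteq\sigma,|\sigma'|=|\sigma|-1}[\sigma:\sigma']\frac{\operatorname{lcm}(\sigma)}{\operatorname{lcm}(\sigma')}\sigma'$, where $[\sigma:\sigma']=\pm1$ are the simplicial boundary signs. The Scarf complex is the subcomplex of the Taylor resolution spanned by the subsets $\sigma$ such that $\operatorname{lcm}(\tau)\neq\operatorname{lcm}(\sigma)$ for all $\tau\ne\sigma$. Matchings. Let $G=(V,E)$ be the directed graph whose vertices are all subsets of $\mathcal G(I)$ and whose edges are the pairs $(\sigma,\sigma')$ with $\sigma'\subseteq\sigma$, $|\sigma'|=|\sigma|-1$; for $A\subseteq E$ let $G^A$ be obtained by reversing the edges in $A$. $A$ is an $\operatorname{lcm}$-homogeneous acyclic matching if every subset appears in at most one edge of $A$, $G^A$ has no directed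 cycle, and $\operatorname{lcm}(\sigma)=\operatorname{lcm}(\sigma')$ for $(\sigma,\sigma')\in A$. Subsets in no edge of $A$ are critical. For an edge $(\sigma,\sigma')$ of $G^A$ put $m(\sigma,\sigma')=-[\sigma':\sigma]$ if $(\sigma',\sigma)\in A$, and $[\sigma:\sigma']$ otherwise; a gradient path $\mathcal P$ is a directed path in $G^A$ and $m(\mathcal P)$ is the product of the $m$'s of its edges. Such an $A$ induces a free resolution $\mathcal F_A$ of $R/I$ with $(\mathcal F_A)_r$ free on the critical subsets of cardinality $r$ and $$\partial_r^A(\sigma)=\sum_{\sigma'\subseteq\sigma,\,|\sigma'|=r-1}[\sigma:\sigma']\sum_{\sigma''\text{ critical},\,|\sigma''|=r-1}\ \sum_{\mathcal P:\sigma'\to\cdots\to\sigma''} m(\mathcal P)\frac{\operatorname{lcm}(\sigma)}{\operatorname{lcm}(\sigma'')}\sigma''.$$ Barile-Macchia resolution (w.r.t. $>_I$). $m$ is a bridge of $\sigma$ if $m\in\sigma$ and $\operatorname{lcm}(\sigma\setminus m)=\operatorname{lcm}(\sigma)$; $\operatorname{sb}(\sigma)$ is the $>_I$-smallest bridge of $\sigma$, or $\emptyset$ if there is none ($\sigma\setminus\emptyset=\sigma$). Start with $A=\emptyset$, $\Omega=\{\sigma\subseteq\mathcal G(I):|\sigma|\ge3\}$. (1) Pick $\sigma\in\Omega$ of maximal cardinality. (2) Replace $\Omega$ by $\Omega\setminus\{\sigma,\sigma\setminus\operatorname{sb}(\sigma)\}$; if $\operatorname{sb}(\sigma)\ne\emptyset$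 add $(\sigma,\sigma\setminus\operatorname{sb}(\sigma))$ to $A$; if $\Omega\ne\emptyset$ return to (1). (3) Whenever two distinct edges of $A$ have the same target, remove the one whose smallest bridge $\operatorname{sb}$ of its source is larger w.r.t. $>_I$. The Barile-Macchia resolution is $\mathcal F_A$ for the resulting $A$. A subset $\sigma$ is potentially-type-2 if $(\sigma,\sigma\setminus\operatorname{sb}(\sigma))$ is added in step (2), and type-2 if this edge remains in the final $A$. $I$ is bridge-friendly if there is a total ordering $>_I$ (and then bridge-friendly with respect to it) for which all potentially-type-2 subsets are type-2. The Barile-Macchia resolution of $R/I$ induced by an ordering with respect to which $I$ is bridge-friendly is minimal; this is the minimal Barile-Macchia resolution referred to in the claim.
   Formalization: The claim about the Scarf complex is stated for I ≠ R only: for I = R, G(I) = {1}, the Barile-Macchia resolution is R → R (not minimal) while the Scarf complex is 0; bridge-friendliness is still claimed for I = R. *)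

theory Defs
  imports Complex_Main "HOL-Library.Poly_Mapping" "HOL-Library.FuncSet"
begin

section \<open>Monomial ideals\<close>

text \<open>
  A monomial in the variables indexed by \<open>'n\<close> is represented by its exponent vector, so that the
  polynomial ring is the monoid algebra of the exponent vectors.
\<close>

type_synonym 'n monomial = "'n \<Rightarrow>\<^sub>0 nat"
type_synonym ('n, 'k) mpoly = "'n monomial \<Rightarrow>\<^sub>0 'k"

definition monom :: "'n monomial \<Rightarrow> ('n, 'k::field) mpoly" where
  "monom m = Poly_Mapping.single m 1"

text \<open>The ideals of a commutative ring are its submodules, and \<open>module.span (*) X\<close> is the ideal
  generated by \<open>X\<close>.\<close>

definition monomial_ideal :: "('n, 'k::field) mpoly set \<Rightarrow> bool" where
  "monomial_ideal I \<longleftrightarrow> (\<exists>S. I = module.span (*) (monom ` S))"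

text \<open>Minimality is with respect to inclusion.\<close>

definition is_minimal_generating_set :: "('n, 'k::field) mpoly set \<Rightarrow> 'n monomial set \<Rightarrow> bool" where
  "is_minimal_generating_set I S \<longleftrightarrow>
     module.span (*) (monom ` S) = I \<and> (\<forall>T. T \<subset> S \<longrightarrow> module.span (*) (monom ` T) \<noteq> I)"

definition min_gens :: "('n, 'k::field) mpoly set \<Rightarrow> 'n monomial set" where
  "min_gens I = (THE S. is_minimal_generating_set I S)"

lemma ring_module: "module ((*) :: 'a::comm_ring_1 \<Rightarrow> 'a \<Rightarrow> 'a)"
  by unfold_locales (auto simp: algebra_simps)

lemma keys_in_monomial_span:
  fixes f :: "('n, 'k::field) mpoly"
  assumes "f \<in> module.span (*) (monom ` S)" "m \<in> Poly_Mapping.keys f"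
  shows "\<exists>s\<in>S. \<exists>t. m = s + t"
proof -
  interpret module "(*) :: ('n, 'k) mpoly \<Rightarrow> _" by (rule ring_module)
  let ?V = "{f :: ('n, 'k) mpoly. \<forall>m\<in>Poly_Mapping.keys f. \<exists>s\<in>S. \<exists>t. m = s + t}"
  have "subspace ?V"
  proof (rule subspaceI)
    fix f g :: "('n, 'k) mpoly" assume "f \<in> ?V" "g \<in> ?V"
    then show "f + g \<in> ?V" using keys_add[of f g] by blast
  next
    fix c f :: "('n, 'k) mpoly" assume f: "f \<in> ?V"
    show "c * f \<in> ?V"
    proof safe
      fix m assume "m \<in> Poly_Mapping.keys (c * f)"
      then obtain a b where "m = a + b" "b \<in> Poly_Mapping.keys f" using keys_mult[of c f] by blast
      moreover then obtain s t where "s \<in> S" "b = s + t" using f by blast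
      ultimately show "\<exists>s\<in>S. \<exists>t. m = s + t" by (metis add.assoc add.commute)
    qed
  qed simp
  moreover have "monom ` S \<subseteq> ?V"
    by (auto simp: monom_def) (metis add.right_neutral)
  ultimately have "span (monom ` S) \<subseteq> ?V" by (rule span_minimal[rotated])
  then show ?thesis using assms by blast
qed

lemma monom_in_monomial_span_iff:
  "(monom m :: ('n, 'k::field) mpoly) \<in> module.span (*) (monom ` S) \<longleftrightarrow> (\<exists>s\<in>S. \<exists>t. m = s + t)"
proof
  assume "(monom m :: ('n, 'k) mpoly) \<in> module.span (*) (monom ` S)"
  then show "\<exists>s\<in>S. \<exists>t. m = s + t" by (rule keys_in_monomial_span) (simp add: monom_def)
next
  interpret module "(*) :: ('n, 'k) mpoly \<Rightarrow> _" by (rule ring_module)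
  assume "\<exists>s\<in>S. \<exists>t. m = s + t"
  then obtain s t where "s \<in> S" "m = s + t" by blast
  then have "(monom m :: ('n, 'k) mpoly) = monom t * monom s"
    by (simp add: monom_def mult_single add.commute)
  then show "(monom m :: ('n, 'k) mpoly) \<in> span (monom ` S)"
    using \<open>s \<in> S\<close> by (metis imageI span_base span_scale)
qed

lemma minimal_generating_set_unique:
  fixes I :: "('n::finite, 'k::field) mpoly set"
  assumes "monomial_ideal I"
  shows "\<exists>!S. is_minimal_generating_set I S"
proof -
  interpret module "(*) :: ('n, 'k) mpoly \<Rightarrow> _" by (rule ring_module)
  obtain S\<^sub>0 where S\<^sub>0: "I = span (monom ` S\<^sub>0)" using assms by (auto simp: monomial_ideal_def)
  define M where "M = {m. (monom m :: ('n, 'k) mpoly) \<in> I \<and>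
    (\<forall>m' t. (monom m' :: ('n, 'k) mpoly) \<in> I \<longrightarrow> m = m' + t \<longrightarrow> m' = m)}"
  have below: "\<exists>m'\<in>M. \<exists>t. m = m' + t" if "(monom m :: ('n, 'k) mpoly) \<in> I" for m
    using that
  proof (induction "\<Sum>i\<in>UNIV. Poly_Mapping.lookup m i" arbitrary: m rule: less_induct)
    case less
    show ?case
    proof (cases "m \<in> M")
      case True
      then show ?thesis by (metis add.right_neutral)
    next
      case False
      then obtain m' t where m': "(monom m' :: ('n, 'k) mpoly) \<in> I" "m = m' + t" "m' \<noteq> m"
        using less.prems by (auto simp: M_def)
      have "t \<noteq> 0" using m' by auto
      then obtain i where "Poly_Mapping.lookup t i \<noteq> 0" by (metis lookup_zero poly_mapping_eqI)
      then have "(\<Sum>i\<in>UNIV. Poly_Mapping.lookup m' i) < (\<Sum>i\<in>UNIV. Poly_Mapping.lookup m i)"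
        unfolding m'(2) lookup_add by (intro sum_strict_mono_ex1) auto
      from less.hyps[OF this m'(1)] show ?thesis using m'(2) by (metis add.assoc)
    qed
  qed
  have gen: "span (monom ` M) = I"
  proof (rule antisym)
    show "span (monom ` M) \<subseteq> I"
      unfolding S\<^sub>0 by (rule span_minimal) (auto simp: M_def S\<^sub>0)
    have "(monom s :: ('n, 'k) mpoly) \<in> span (monom ` M)" if "s \<in> S\<^sub>0" for s
    proof -
      have "(monom s :: ('n, 'k) mpoly) \<in> I" unfolding S\<^sub>0 using that by (intro span_base imageI)
      then show ?thesis unfolding monom_in_monomial_span_iff by (rule below)
    qed
    then show "I \<subseteq> span (monom ` M)"
      unfolding S\<^sub>0 by (intro span_minimal subspace_span image_subsetI)
  qed
  have sub: "M \<subseteq> S" if "span (monom ` S) = I" for S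
  proof
    fix m assume "m \<in> M"
    then have "(monom m :: ('n, 'k) mpoly) \<in> span (monom ` S)" using that by (simp add: M_def)
    then obtain s t where st: "s \<in> S" "m = s + t" by (auto simp: monom_in_monomial_span_iff)
    moreover have "(monom s :: ('n, 'k) mpoly) \<in> I" using st that span_base by blast
    ultimately show "m \<in> S" using \<open>m \<in> M\<close> by (auto simp: M_def)
  qed
  show ?thesis
  proof (rule ex1I)
    show "is_minimal_generating_set I M"
      using gen sub by (auto simp: is_minimal_generating_set_def)
    show "S = M" if "is_minimal_generating_set I S" for S
      using that gen sub by (metis is_minimal_generating_set_def psubsetI)
  qed
qed

definition mlcm :: "'n::finite monomial set \<Rightarrow> 'n monomial" where
  "mlcm \<sigma> = Abs_poly_mapping (\<lambda>i. Max (insert 0 ((\<lambda>m. Poly_Mapping.lookup m i) ` \<sigma>)))"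

lemma lookup_mlcm: "Poly_Mapping.lookup (mlcm \<sigma>) i = Max (insert 0 ((\<lambda>m. Poly_Mapping.lookup m i) ` \<sigma>))"
  by (simp add: mlcm_def)


section \<open>Taylor resolution and Scarf complex\<close>

text \<open>
  The elements of the free \<open>'a\<close>-module on a set \<open>B\<close> are the finitely supported functions with
  support in \<open>B\<close>. A complex of modules of this kind is given by its modules and its differentials,
  the \<open>r\<close>-th of which goes from degree \<open>r\<close> to degree \<open>r - 1\<close> (and is zero for \<open>r = 0\<close>).
  Differentials are made \<open>undefined\<close> outside their domain, so that
  equality of records is equality of complexes.
\<close>

record (overloaded) ('b, 'a) free_complex =
  chains :: "nat \<Rightarrow> ('b \<Rightarrow>\<^sub>0 'a) set"
  differential :: "nat \<Rightarrow> ('b \<Rightarrow>\<^sub>0 'a) \<Rightarrow> ('b \<Rightarrow>\<^sub>0 'a)"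

definition free_on :: "'b set \<Rightarrow> ('b \<Rightarrow>\<^sub>0 'a::zero) set" where
  "free_on B = {f. Poly_Mapping.keys f \<subseteq> B}"

definition linear_extension :: "('b \<Rightarrow> 'b \<Rightarrow>\<^sub>0 'a) \<Rightarrow> ('b \<Rightarrow>\<^sub>0 'a::comm_ring_1) \<Rightarrow> ('b \<Rightarrow>\<^sub>0 'a)" where
  "linear_extension \<phi> f = (\<Sum>b\<in>Poly_Mapping.keys f. Poly_Mapping.map ((*) (Poly_Mapping.lookup f b)) (\<phi> b))"

definition complex_on_cells ::
    "'m set set \<Rightarrow> ('m set \<Rightarrow> 'm set \<Rightarrow>\<^sub>0 'a) \<Rightarrow> ('m set, 'a::comm_ring_1) free_complex" where
  "complex_on_cells X \<phi> =
     (let C = (\<lambda>r. free_on {\<sigma> \<in> X. card \<sigma> = r})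
      in \<lparr>chains = C, differential = (\<lambda>r. restrict (linear_extension \<phi>) (C r))\<rparr>)"

definition spanned_subcomplex ::
    "('b, 'a::zero) free_complex \<Rightarrow> 'b set \<Rightarrow> ('b, 'a) free_complex" where
  "spanned_subcomplex F X =
     (let C = (\<lambda>r. chains F r \<inter> free_on X)
      in \<lparr>chains = C, differential = (\<lambda>r. restrict (differential F r) (C r))\<rparr>)"

definition facets :: "'m set \<Rightarrow> 'm set set" where
  "facets \<sigma> = {\<sigma>'. \<sigma>' \<subseteq> \<sigma> \<and> Suc (card \<sigma>') = card \<sigma>}"

text \<open>
  A total ordering is a reflexive relation as in \<^const>\<open>linear_order_on\<close>, with \<open>(m, m') \<in> ord\<close>
  meaning that \<open>m\<close> is smaller than or equal to \<open>m'\<close>. The simplices are oriented by listing their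
  vertices in increasing order: removing a vertex that is preceded by \<open>j\<close> others gives the
  sign \<open>(-1)^j\<close>.
\<close>

definition boundary_sign :: "'m rel \<Rightarrow> 'm set \<Rightarrow> 'm set \<Rightarrow> int" where
  "boundary_sign ord \<sigma> \<sigma>' = (-1) ^ card {u \<in> \<sigma>'. \<exists>v \<in> \<sigma> - \<sigma>'. (u, v) \<in> ord}"

definition taylor_boundary ::
    "'n::finite monomial rel \<Rightarrow> 'n monomial set \<Rightarrow> ('n monomial set \<Rightarrow>\<^sub>0 ('n, 'k::field) mpoly)" where
  "taylor_boundary ord \<sigma> =
     (\<Sum>\<sigma>'\<in>facets \<sigma>. Poly_Mapping.single \<sigma>'
        (of_int (boundary_sign ord \<sigma> \<sigma>') * monom (mlcm \<sigma> - mlcm \<sigma>')))"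

definition taylor_resolution ::
    "('n::finite, 'k::field) mpoly set \<Rightarrow> 'n monomial rel
     \<Rightarrow> ('n monomial set, ('n, 'k) mpoly) free_complex" where
  "taylor_resolution I ord = complex_on_cells (Pow (min_gens I)) (taylor_boundary ord)"

definition scarf_sets :: "'n::finite monomial set \<Rightarrow> 'n monomial set set" where
  "scarf_sets G = {\<sigma>. \<sigma> \<subseteq> G \<and> (\<forall>\<tau>. \<tau> \<subseteq> G \<longrightarrow> \<tau> \<noteq> \<sigma> \<longrightarrow> mlcm \<tau> \<noteq> mlcm \<sigma>)}"

definition scarf_complex ::
    "('n::finite, 'k::field) mpoly set \<Rightarrow> 'n monomial rel
     \<Rightarrow> ('n monomial set, ('n, 'k) mpoly) free_complex" where
  "scarf_complex I ord = spanned_subcomplex (taylor_resolution I ord) (scarf_sets (min_gens I))"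


section \<open>Complexes induced by matchings\<close>

type_synonym 'm matching = "('m set \<times> 'm set) set"

definition subset_graph :: "'m set \<Rightarrow> ('m set \<times> 'm set) set" where
  "subset_graph G = {(\<sigma>, \<sigma>'). \<sigma> \<subseteq> G \<and> \<sigma>' \<in> facets \<sigma>}"

definition reversed_graph :: "'m set \<Rightarrow> 'm matching \<Rightarrow> ('m set \<times> 'm set) set" where
  "reversed_graph G A = (subset_graph G - A) \<union> A\<inverse>"

definition critical_sets :: "'m set \<Rightarrow> 'm matching \<Rightarrow> 'm set set" where
  "critical_sets G A = Pow G - Field A"

text \<open>A directed path is given by the list of its vertices; a single vertex is a path without
  edges. Requiring the vertices to be distinct is no restriction when the graph has no directed
  cycle.\<close>

definition gradient_paths :: "'m set \<Rightarrow> 'm matching \<Rightarrow> 'm set \<Rightarrow> 'm set \<Rightarrow> 'm set list set" where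
  "gradient_paths G A \<sigma> \<tau> =
     {p. p \<noteq> [] \<and> hd p = \<sigma> \<and> last p = \<tau> \<and> set p \<subseteq> Pow G \<and> distinct p \<and>
         successively (\<lambda>a b. (a, b) \<in> reversed_graph G A) p}"

definition edge_weight :: "'m rel \<Rightarrow> 'm matching \<Rightarrow> 'm set \<times> 'm set \<Rightarrow> int" where
  "edge_weight ord A = (\<lambda>(\<sigma>, \<sigma>').
     if (\<sigma>', \<sigma>) \<in> A then - boundary_sign ord \<sigma>' \<sigma> else boundary_sign ord \<sigma> \<sigma>')"

definition path_weight :: "'m rel \<Rightarrow> 'm matching \<Rightarrow> 'm set list \<Rightarrow> int" where
  "path_weight ord A p = prod_list (map (edge_weight ord A) (zip p (tl p)))"

definition morse_boundary ::
    "'n::finite monomial set \<Rightarrow> 'n monomial rel \<Rightarrow> 'n monomial matching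
     \<Rightarrow> 'n monomial set \<Rightarrow> ('n monomial set \<Rightarrow>\<^sub>0 ('n, 'k::field) mpoly)" where
  "morse_boundary G ord A \<sigma> =
     (\<Sum>\<sigma>'\<in>facets \<sigma>. \<Sum>\<sigma>'' | \<sigma>'' \<in> critical_sets G A \<and> Suc (card \<sigma>'') = card \<sigma>.
        \<Sum>p\<in>gradient_paths G A \<sigma>' \<sigma>''.
          Poly_Mapping.single \<sigma>''
            (of_int (boundary_sign ord \<sigma> \<sigma>' * path_weight ord A p)
              * monom (mlcm \<sigma> - mlcm \<sigma>'')))"

definition morse_complex ::
    "('n::finite, 'k::field) mpoly set \<Rightarrow> 'n monomial rel \<Rightarrow> 'n monomial matching
     \<Rightarrow> ('n monomial set, ('n, 'k) mpoly) free_complex" where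
  "morse_complex I ord A =
     complex_on_cells (critical_sets (min_gens I) A) (morse_boundary (min_gens I) ord A)"


section \<open>Barile--Macchia resolutions\<close>

definition bridges :: "'n::finite monomial set \<Rightarrow> 'n monomial set" where
  "bridges \<sigma> = {m \<in> \<sigma>. mlcm (\<sigma> - {m}) = mlcm \<sigma>}"

text \<open>The smallest bridge is encoded as a set: a singleton, or empty if there are no bridges.\<close>

definition sb :: "'n::finite monomial rel \<Rightarrow> 'n monomial set \<Rightarrow> 'n monomial set" where
  "sb ord \<sigma> = {m \<in> bridges \<sigma>. \<forall>m' \<in> bridges \<sigma>. (m, m') \<in> ord}"

text \<open>One round of steps (1) and (2) of the algorithm, on the states \<open>(\<Omega>, A)\<close>.\<close>

inductive bm_step ::
    "'n::finite monomial rel \<Rightarrow> 'n monomial set set \<times> 'n monomial matching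
     \<Rightarrow> 'n monomial set set \<times> 'n monomial matching \<Rightarrow> bool"
  for ord where
  "\<sigma> \<in> \<Omega> \<Longrightarrow> \<forall>\<tau>\<in>\<Omega>. card \<tau> \<le> card \<sigma> \<Longrightarrow>
   bm_step ord (\<Omega>, A)
     (\<Omega> - {\<sigma>, \<sigma> - sb ord \<sigma>},
      if sb ord \<sigma> = {} then A else insert (\<sigma>, \<sigma> - sb ord \<sigma>) A)"

definition bm_start :: "'m set \<Rightarrow> 'm set set \<times> 'm matching" where
  "bm_start G = ({\<sigma>. \<sigma> \<subseteq> G \<and> 3 \<le> card \<sigma>}, {})"

text \<open>For finite \<open>G\<close> the outcome of steps (1) and (2) does not depend on the choices made in
  step (1), as shown in \<open>bm_candidates_unique\<close> below. The minimal generating set of a monomial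
  ideal is finite by Dickson's lemma.\<close>

definition bm_candidates :: "'n::finite monomial set \<Rightarrow> 'n monomial rel \<Rightarrow> 'n monomial matching" where
  "bm_candidates G ord = (THE A. (bm_step ord)\<^sup>*\<^sup>* (bm_start G) ({}, A))"

lemma bm_run_unique:
  assumes "finite \<Omega>" "\<And>\<sigma>. \<sigma> \<in> \<Omega> \<Longrightarrow> finite \<sigma>"
  shows "\<exists>!A'. (bm_step ord)\<^sup>*\<^sup>* (\<Omega>, A) ({}, A')"
  using assms
proof (induction "card \<Omega>" arbitrary: \<Omega> A rule: less_induct)
  case less
  let ?next = "\<lambda>\<Omega> A \<sigma>. (\<Omega> - {\<sigma>, \<sigma> - sb ord \<sigma>},
      if sb ord \<sigma> = {} then A else insert (\<sigma>, \<sigma> - sb ord \<sigma>) A)"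
  have IH: "\<exists>!A'. (bm_step ord)\<^sup>*\<^sup>* (\<Omega> - X, B) ({}, A')" if "\<sigma> \<in> \<Omega>" "\<sigma> \<in> X" for \<sigma> X B
    using that less.prems by (intro less.hyps psubset_card_mono) auto
  show ?case
  proof (cases "\<Omega> = {}")
    case True
    have "A' = A" if "(bm_step ord)\<^sup>*\<^sup>* ({}, A) ({}, A')" for A'
      using that by (cases rule: converse_rtranclpE) (auto elim: bm_step.cases)
    then show ?thesis using True by blast
  next
    case False
    define T where "T = {\<sigma> \<in> \<Omega>. \<forall>\<tau>\<in>\<Omega>. card \<tau> \<le> card \<sigma>}"
    have step: "bm_step ord (\<Omega>, A) (?next \<Omega> A \<sigma>)" if "\<sigma> \<in> T" for \<sigma>
      using that unfolding T_def by (intro bm_step.intros) auto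
    obtain \<sigma> where \<sigma>: "\<sigma> \<in> T"
    proof -
      have "Max (card ` \<Omega>) \<in> card ` \<Omega>" using False less.prems(1) by (intro Max_in) auto
      then obtain \<sigma> where "\<sigma> \<in> \<Omega>" "card \<sigma> = Max (card ` \<Omega>)" by (metis imageE)
      then have "\<sigma> \<in> T" using less.prems(1) by (simp add: T_def)
      then show ?thesis by (rule that)
    qed
    then obtain A1 where A1: "(bm_step ord)\<^sup>*\<^sup>* (?next \<Omega> A \<sigma>) ({}, A1)"
      using IH[of \<sigma> "{\<sigma>, \<sigma> - sb ord \<sigma>}"] unfolding T_def by blast
    have "A2 = A1" if A2: "(bm_step ord)\<^sup>*\<^sup>* (\<Omega>, A) ({}, A2)" for A2
    proof -
      from A2 False obtain \<tau> where \<tau>: "\<tau> \<in> T" "(bm_step ord)\<^sup>*\<^sup>* (?next \<Omega> A \<tau>) ({}, A2)"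
      proof (cases rule: converse_rtranclpE)
        case base
        then show ?thesis using False by simp
      next
        case (step y)
        from step(1) obtain \<tau> where "\<tau> \<in> T" "y = ?next \<Omega> A \<tau>"
          by cases (unfold T_def, blast)
        then show ?thesis using that step(2) by blast
      qed
      show ?thesis
      proof (cases "\<tau> = \<sigma>")
        case True
        moreover have "\<sigma> \<in> \<Omega>" using \<sigma> by (simp add: T_def)
        ultimately show ?thesis using IH[of \<sigma> "{\<sigma>, \<sigma> - sb ord \<sigma>}"] \<tau>(2) A1 by blast
      next
        case ne: False
        have not_sub: "b \<noteq> a - sb ord a" if "a \<in> T" "b \<in> T" "a \<noteq> b" for a b
        proof
          assume b: "b = a - sb ord a"
          have "card a = card b" "finite a" using that less.prems by (auto simp: T_def le_antisym)
          moreover have "b \<subseteq> a" using b by blast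
          ultimately show False using that(3) by (metis card_subset_eq)
        qed
        have diamond: "bm_step ord (?next \<Omega> A a)
            (\<Omega> - {a, a - sb ord a, b, b - sb ord b},
             A \<union> {(c, c - sb ord c) |c. c \<in> {a, b} \<and> sb ord c \<noteq> {}})"
          if "a \<in> T" "b \<in> T" "a \<noteq> b" for a b
        proof -
          have "b \<in> \<Omega> - {a, a - sb ord a}" using that not_sub[of a b] by (auto simp: T_def)
          moreover have "\<forall>\<tau>\<in>\<Omega> - {a, a - sb ord a}. card \<tau> \<le> card b"
            using that by (auto simp: T_def)
          ultimately have "bm_step ord (?next \<Omega> A a)
            (?next (\<Omega> - {a, a - sb ord a})
               (if sb ord a = {} then A else insert (a, a - sb ord a) A) b)"
            by (rule bm_step.intros)
          moreover have "\<Omega> - {a, a - sb ord a} - {b, b - sb ord b}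
              = \<Omega> - {a, a - sb ord a, b, b - sb ord b}" by blast
          moreover have "(if sb ord b = {} then B else insert (b, b - sb ord b) B)
              = A \<union> {(c, c - sb ord c) |c. c \<in> {a, b} \<and> sb ord c \<noteq> {}}"
            if "B = (if sb ord a = {} then A else insert (a, a - sb ord a) A)" for B
            unfolding that by auto
          ultimately show ?thesis by simp
        qed
        define Z where "Z = (\<Omega> - {\<sigma>, \<sigma> - sb ord \<sigma>, \<tau>, \<tau> - sb ord \<tau>},
             A \<union> {(c, c - sb ord c) |c. c \<in> {\<sigma>, \<tau>} \<and> sb ord c \<noteq> {}})"
        have Z1: "bm_step ord (?next \<Omega> A \<sigma>) Z"
          using diamond[OF \<sigma> \<tau>(1)] ne by (auto simp: Z_def)
        have "bm_step ord (?next \<Omega> A \<tau>) Z"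
          using diamond[OF \<tau>(1) \<sigma> ne] by (simp add: Z_def insert_commute)
        moreover obtain A3 where A3: "(bm_step ord)\<^sup>*\<^sup>* Z ({}, A3)"
          using IH[of \<sigma> "{\<sigma>, \<sigma> - sb ord \<sigma>, \<tau>, \<tau> - sb ord \<tau>}"] \<sigma> unfolding T_def Z_def by blast
        ultimately have "(bm_step ord)\<^sup>*\<^sup>* (?next \<Omega> A \<tau>) ({}, A3)"
          by (rule converse_rtranclp_into_rtranclp)
        moreover have "(bm_step ord)\<^sup>*\<^sup>* (?next \<Omega> A \<sigma>) ({}, A3)"
          using Z1 A3 by (rule converse_rtranclp_into_rtranclp)
        moreover have "\<sigma> \<in> \<Omega>" "\<tau> \<in> \<Omega>" using \<sigma> \<tau> by (auto simp: T_def)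
        ultimately show ?thesis
          using IH[of \<sigma> "{\<sigma>, \<sigma> - sb ord \<sigma>}"] IH[of \<tau> "{\<tau>, \<tau> - sb ord \<tau>}"] A1 \<tau>(2) by blast
      qed
    qed
    moreover have "(bm_step ord)\<^sup>*\<^sup>* (\<Omega>, A) ({}, A1)"
      using step[OF \<sigma>] A1 by (rule converse_rtranclp_into_rtranclp)
    ultimately show ?thesis by blast
  qed
qed

lemma bm_candidates_unique:
  assumes "finite G"
  shows "\<exists>!A. (bm_step ord)\<^sup>*\<^sup>* (bm_start G) ({}, A)"
  unfolding bm_start_def using assms by (intro bm_run_unique) (auto intro: finite_subset)

definition bm_matching :: "'n::finite monomial set \<Rightarrow> 'n monomial rel \<Rightarrow> 'n monomial matching" where
  "bm_matching G ord = bm_candidates G ord -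
     {(\<sigma>, \<tau>). \<exists>\<sigma>'. (\<sigma>', \<tau>) \<in> bm_candidates G ord \<and> \<sigma>' \<noteq> \<sigma> \<and>
        (\<exists>m \<in> sb ord \<sigma>. \<exists>m' \<in> sb ord \<sigma>'. (m', m) \<in> ord \<and> m' \<noteq> m)}"

definition barile_macchia_resolution ::
    "('n::finite, 'k::field) mpoly set \<Rightarrow> 'n monomial rel
     \<Rightarrow> ('n monomial set, ('n, 'k) mpoly) free_complex" where
  "barile_macchia_resolution I ord = morse_complex I ord (bm_matching (min_gens I) ord)"

definition potentially_type_2 ::
    "('n::finite, 'k::field) mpoly set \<Rightarrow> 'n monomial rel \<Rightarrow> 'n monomial set \<Rightarrow> bool" where
  "potentially_type_2 I ord \<sigma> \<longleftrightarrow> (\<sigma>, \<sigma> - sb ord \<sigma>) \<in> bm_candidates (min_gens I) ord"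

definition type_2 ::
    "('n::finite, 'k::field) mpoly set \<Rightarrow> 'n monomial rel \<Rightarrow> 'n monomial set \<Rightarrow> bool" where
  "type_2 I ord \<sigma> \<longleftrightarrow> (\<sigma>, \<sigma> - sb ord \<sigma>) \<in> bm_matching (min_gens I) ord"

definition bridge_friendly_wrt ::
    "('n::finite, 'k::field) mpoly set \<Rightarrow> 'n monomial rel \<Rightarrow> bool" where
  "bridge_friendly_wrt I ord \<longleftrightarrow>
     linear_order_on (min_gens I) ord \<and> (\<forall>\<sigma>. potentially_type_2 I ord \<sigma> \<longrightarrow> type_2 I ord \<sigma>)"

definition bridge_friendly :: "('n::finite, 'k::field) mpoly set \<Rightarrow> bool" where
  "bridge_friendly I \<longleftrightarrow> (\<exists>ord. bridge_friendly_wrt I ord)"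

end

theory Submission
  imports Defs
begin

text \<open>
  Fix a monomial \<open>l\<close> and look at the sets of minimal generators with lcm \<open>l\<close>. A set lying between two
  members of this class is again a member, and the union of all members is a member, the hull. By
  hypothesis the class is also closed under intersection, so it is a Boolean interval \<open>[\<mu>, H]\<close>, and
  the bridges of a member \<open>\<sigma>\<close> are exactly the elements of \<open>\<sigma> - \<mu>\<close>. Hence being a bridge depends on the
  class only (\<open>bridges_eq_hull\<close>).

  If \<open>\<mu> \<noteq> H\<close>, let the pivot \<open>s\<close> be the smallest element of \<open>H - \<mu>\<close>, the smallest bridge of \<open>H\<close>. The
  class splits into the pairs consisting of a set containing \<open>s\<close> and the same set without \<open>s\<close>. Since
  the larger set of a pair has smallest bridge \<open>s\<close> and is processed first, the Barile--Macchia
  algorithm selects exactly these pairs (\<open>bm_candidates_eq\<close>). They are disjoint, so no two of them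
  share a target and nothing is removed afterwards: every total ordering is bridge-friendly.

  Each class with more than one member is matched completely. The bound on the cardinality in the
  algorithm does no harm: as no minimal generator divides another one or equals \<open>1\<close> (which is where
  \<open>I \<noteq> UNIV\<close> enters), a set with a bridge has at least three elements. So the critical sets
  are those that are alone in their class, which are the Scarf sets (\<open>critical_sets_eq_scarf\<close>).

  Subsets of Scarf sets are Scarf sets. Therefore all facets of a critical set are critical, and a
  gradient path between critical sets of equal cardinality is trivial
  (\<open>gradient_paths_between_critical\<close>). The differential of the Morse complex thus reduces to that of
  the Taylor resolution.
\<close>


section \<open>Finiteness of the minimal generating set\<close>

lemma nat_seq_mono_subseq:
  fixes h :: "nat \<Rightarrow> nat"
  shows "\<exists>q :: nat \<Rightarrow> nat. strict_mono q \<and> mono (\<lambda>n. h (q n))"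
proof -
  obtain q :: "nat \<Rightarrow> nat" where q: "strict_mono q" "monoseq (\<lambda>n. h (q n))"
    using seq_monosub by blast
  from q(2) consider "incseq (\<lambda>n. h (q n))" | "decseq (\<lambda>n. h (q n))"
    unfolding monoseq_iff by blast
  then show ?thesis
  proof cases
    case 1
    then show ?thesis using q(1) by blast
  next
    case 2
    \<comment> \<open>A nonincreasing sequence of naturals is constant from the point where it attains its minimum.\<close>
    obtain N where N: "\<And>n. h (q N) \<le> h (q n)"
      using ex_has_least_nat[of "\<lambda>_. True" _ "\<lambda>n. h (q n)"] by blast
    have "h (q (n + N)) = h (q N)" for n
      using N[of "n + N"] decseqD[OF 2, of N "n + N"] by simp
    then have "mono (\<lambda>n. h (q (n + N)))" by (simp add: mono_def)
    moreover have "strict_mono (\<lambda>n. q (n + N))"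
      using q(1) by (simp add: strict_mono_def)
    ultimately show ?thesis by (intro exI[of _ "\<lambda>n. q (n + N)"]) simp
  qed
qed

lemma simultaneous_mono_subseq:
  fixes g :: "'a \<Rightarrow> nat \<Rightarrow> nat"
  assumes "finite K"
  shows "\<exists>r :: nat \<Rightarrow> nat. strict_mono r \<and> (\<forall>k\<in>K. mono (\<lambda>n. g k (r n)))"
  using assms
proof induction
  case empty
  show ?case by (intro exI[of _ id]) (simp add: strict_mono_def)
next
  case (insert x K)
  then obtain r :: "nat \<Rightarrow> nat" where r: "strict_mono r" "\<forall>k\<in>K. mono (\<lambda>n. g k (r n))" by blast
  obtain q :: "nat \<Rightarrow> nat" where q: "strict_mono q" "mono (\<lambda>n. g x (r (q n)))"
    using nat_seq_mono_subseq[of "\<lambda>n. g x (r n)"] by blast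
  have "strict_mono (\<lambda>n. r (q n))" using r(1) q(1) by (simp add: strict_mono_def)
  moreover have "mono (\<lambda>n. g k (r (q n)))" if "k \<in> K" for k
    using r(2) that strict_mono_mono[OF q(1)] by (auto simp: mono_def)
  ultimately show ?case using q(2) by (intro exI[of _ "\<lambda>n. r (q n)"]) auto
qed

lemma monomial_dvd_iff:
  "(\<exists>t. b = a + t) \<longleftrightarrow> (\<forall>i. Poly_Mapping.lookup a i \<le> Poly_Mapping.lookup b i)"
  for a b :: "'n monomial"
proof
  assume "\<forall>i. Poly_Mapping.lookup a i \<le> Poly_Mapping.lookup b i"
  then have "b = a + (b - a)" by (intro poly_mapping_eqI) (simp add: lookup_add lookup_minus)
  then show "\<exists>t. b = a + t" ..
qed (auto simp: lookup_add)

text \<open>Dickson's lemma: a sequence of distinct monomials has a subsequence on which every exponent is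
  nondecreasing, and there earlier terms divide later ones.\<close>

lemma finite_monomial_antichain:
  fixes S :: "'n::finite monomial set"
  assumes antichain: "\<And>a b t. a \<in> S \<Longrightarrow> b \<in> S \<Longrightarrow> b = a + t \<Longrightarrow> a = b"
  shows "finite S"
proof (rule ccontr)
  assume "infinite S"
  then obtain f :: "nat \<Rightarrow> 'n monomial" where f: "inj f" "range f \<subseteq> S"
    using infinite_countable_subset by blast
  obtain r :: "nat \<Rightarrow> nat" where r: "strict_mono r" "\<forall>i\<in>UNIV. mono (\<lambda>n. Poly_Mapping.lookup (f (r n)) i)"
    using simultaneous_mono_subseq[of UNIV "\<lambda>i n. Poly_Mapping.lookup (f n) i"] by auto
  have "\<forall>i. Poly_Mapping.lookup (f (r 0)) i \<le> Poly_Mapping.lookup (f (r 1)) i"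
    using r(2) by (auto simp: mono_def)
  then obtain t where "f (r 1) = f (r 0) + t" by (metis monomial_dvd_iff)
  then have "f (r 0) = f (r 1)" using antichain f(2) by blast
  then have "r 0 = r 1" using f(1) by (simp add: inj_eq)
  then show False using strict_monoD[OF r(1), of 0 1] by simp
qed

lemma min_gens_generate:
  fixes I :: "('n::finite, 'k::field) mpoly set"
  assumes "monomial_ideal I"
  shows "is_minimal_generating_set I (min_gens I)"
  unfolding min_gens_def by (rule theI'[OF minimal_generating_set_unique[OF assms]])

lemma min_gens_antichain:
  fixes I :: "('n::finite, 'k::field) mpoly set"
  assumes "monomial_ideal I" "a \<in> min_gens I" "b \<in> min_gens I" "b = a + t"
  shows "a = b"
proof (rule ccontr)
  assume "a \<noteq> b"
  interpret module "(*) :: ('n, 'k) mpoly \<Rightarrow> _" by (rule ring_module)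
  let ?T = "min_gens I - {b}"
  have gen: "span (monom ` min_gens I) = I"
    and min: "\<And>T. T \<subset> min_gens I \<Longrightarrow> span (monom ` T) \<noteq> I"
    using min_gens_generate[OF assms(1)] by (auto simp: is_minimal_generating_set_def)
  have "(monom b :: ('n, 'k) mpoly) \<in> span (monom ` ?T)"
    using assms \<open>a \<noteq> b\<close> by (subst monom_in_monomial_span_iff) blast
  moreover have "(monom a :: ('n, 'k) mpoly) \<in> span (monom ` ?T)" if "a \<in> ?T" for a
    using that by (intro span_base imageI)
  ultimately have "monom ` min_gens I \<subseteq> span (monom ` ?T :: ('n, 'k) mpoly set)"
    by blast
  then have "span (monom ` min_gens I) \<subseteq> span (monom ` ?T :: ('n, 'k) mpoly set)"
    by (intro span_minimal) auto
  moreover have "span (monom ` ?T) \<subseteq> span (monom ` min_gens I :: ('n, 'k) mpoly set)"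
    by (intro span_mono) auto
  ultimately have "span (monom ` ?T) = I" using gen by blast
  then show False using min[of ?T] assms(3) by blast
qed

lemma finite_min_gens:
  fixes I :: "('n::finite, 'k::field) mpoly set"
  assumes "monomial_ideal I"
  shows "finite (min_gens I)"
  using min_gens_antichain[OF assms] by (rule finite_monomial_antichain)

text \<open>The zero exponent vector is the monomial \<open>1\<close>.\<close>

lemma one_in_min_gens_imp_UNIV:
  fixes I :: "('n::finite, 'k::field) mpoly set"
  assumes "monomial_ideal I" "0 \<in> min_gens I"
  shows "I = UNIV"
proof -
  interpret module "(*) :: ('n, 'k) mpoly \<Rightarrow> _" by (rule ring_module)
  have gen: "span (monom ` min_gens I) = I"
    using min_gens_generate[OF assms(1)] by (auto simp: is_minimal_generating_set_def)
  have "(1 :: ('n, 'k) mpoly) \<in> monom ` min_gens I"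
    using assms(2) by (auto simp: monom_def intro!: image_eqI[of _ _ 0])
  then have "p * 1 \<in> span (monom ` min_gens I)" for p :: "('n, 'k) mpoly"
    by (intro span_scale span_base)
  then show ?thesis using gen by auto
qed


section \<open>Least common multiples\<close>

lemma lookup_mlcm_le_iff:
  assumes "finite \<sigma>"
  shows "Poly_Mapping.lookup (mlcm \<sigma>) i \<le> k \<longleftrightarrow> (\<forall>m\<in>\<sigma>. Poly_Mapping.lookup m i \<le> k)"
  using assms by (simp add: lookup_mlcm)

lemma mlcm_empty: "mlcm {} = 0"
  by (intro poly_mapping_eqI) (simp add: lookup_mlcm)

lemma lookup_le_mlcm:
  assumes "finite \<sigma>" "m \<in> \<sigma>"
  shows "Poly_Mapping.lookup m i \<le> Poly_Mapping.lookup (mlcm \<sigma>) i"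
  using lookup_mlcm_le_iff[OF assms(1)] assms(2) by blast

lemma lookup_mlcm_mono:
  assumes "finite \<tau>" "\<sigma> \<subseteq> \<tau>"
  shows "Poly_Mapping.lookup (mlcm \<sigma>) i \<le> Poly_Mapping.lookup (mlcm \<tau>) i"
  using lookup_le_mlcm[OF assms(1)] assms(2)
  unfolding lookup_mlcm_le_iff[OF finite_subset[OF assms(2,1)]] by blast

lemma mlcm_sandwich:
  assumes "finite \<tau>" "\<sigma> \<subseteq> \<rho>" "\<rho> \<subseteq> \<tau>" "mlcm \<sigma> = mlcm \<tau>"
  shows "mlcm \<rho> = mlcm \<tau>"
proof (rule poly_mapping_eqI)
  fix i
  have "finite \<rho>" using assms(3,1) by (rule finite_subset)
  then show "Poly_Mapping.lookup (mlcm \<rho>) i = Poly_Mapping.lookup (mlcm \<tau>) i"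
    using lookup_mlcm_mono[of \<rho> \<sigma> i] lookup_mlcm_mono[of \<tau> \<rho> i] assms by simp
qed

lemma mlcm_Union_eq:
  assumes "finite (\<Union>F)" "F \<noteq> {}" "\<And>\<sigma>. \<sigma> \<in> F \<Longrightarrow> mlcm \<sigma> = l"
  shows "mlcm (\<Union>F) = l"
proof (rule poly_mapping_eqI)
  fix i
  obtain \<sigma> where "\<sigma> \<in> F" using assms(2) by blast
  then have "Poly_Mapping.lookup l i \<le> Poly_Mapping.lookup (mlcm (\<Union>F)) i"
    using lookup_mlcm_mono[OF assms(1), of \<sigma> i] assms(3) by auto
  moreover have "Poly_Mapping.lookup (mlcm (\<Union>F)) i \<le> Poly_Mapping.lookup l i"
    unfolding lookup_mlcm_le_iff[OF assms(1)]
  proof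
    fix m assume "m \<in> \<Union>F"
    then obtain \<tau> where "\<tau> \<in> F" "m \<in> \<tau>" by blast
    moreover have "finite \<tau>" using assms(1) \<open>\<tau> \<in> F\<close> by (meson Sup_upper finite_subset)
    ultimately show "Poly_Mapping.lookup m i \<le> Poly_Mapping.lookup l i"
      using lookup_le_mlcm[of \<tau> m i] assms(3)[of \<tau>] by simp
  qed
  ultimately show "Poly_Mapping.lookup (mlcm (\<Union>F)) i = Poly_Mapping.lookup l i" by simp
qed

lemma mlcm_Un_cong:
  assumes "finite \<sigma>" "finite \<tau>" "finite \<rho>" "mlcm \<sigma> = mlcm \<tau>"
  shows "mlcm (\<sigma> \<union> \<rho>) = mlcm (\<tau> \<union> \<rho>)"
proof (rule poly_mapping_eqI)
  fix i
  have iff: "Poly_Mapping.lookup (mlcm (\<sigma> \<union> \<rho>)) i \<le> k \<longleftrightarrow>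
      Poly_Mapping.lookup (mlcm (\<tau> \<union> \<rho>)) i \<le> k" for k
    using assms lookup_mlcm_le_iff[of \<sigma> i k] lookup_mlcm_le_iff[of \<tau> i k]
    by (simp add: lookup_mlcm_le_iff ball_Un)
  show "Poly_Mapping.lookup (mlcm (\<sigma> \<union> \<rho>)) i = Poly_Mapping.lookup (mlcm (\<tau> \<union> \<rho>)) i"
    by (rule order_antisym) (simp add: iff, simp add: iff[symmetric])
qed

text \<open>The largest set of generators with the same lcm as \<open>\<sigma>\<close>. Defining it through the lcm makes it
  evident that it depends on the lcm of \<open>\<sigma>\<close> only.\<close>

definition lcm_hull :: "'n::finite monomial set \<Rightarrow> 'n monomial set \<Rightarrow> 'n monomial set" where
  "lcm_hull G \<sigma> = \<Union>{\<tau>. \<tau> \<subseteq> G \<and> mlcm \<tau> = mlcm \<sigma>}"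

lemma lcm_hull_subset: "lcm_hull G \<sigma> \<subseteq> G"
  by (auto simp: lcm_hull_def)

lemma subset_lcm_hull: "\<sigma> \<subseteq> G \<Longrightarrow> \<sigma> \<subseteq> lcm_hull G \<sigma>"
  by (auto simp: lcm_hull_def)

lemma lcm_hull_cong: "mlcm \<sigma> = mlcm \<tau> \<Longrightarrow> lcm_hull G \<sigma> = lcm_hull G \<tau>"
  by (simp add: lcm_hull_def)

lemma mlcm_lcm_hull:
  assumes "finite G" "\<sigma> \<subseteq> G"
  shows "mlcm (lcm_hull G \<sigma>) = mlcm \<sigma>"
  unfolding lcm_hull_def
proof (rule mlcm_Union_eq)
  show "finite (\<Union>{\<tau>. \<tau> \<subseteq> G \<and> mlcm \<tau> = mlcm \<sigma>})"
    by (rule finite_subset[OF _ assms(1)]) blast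
qed (use assms in auto)

text \<open>If a set \<open>\<rho>\<close> had the same lcm as a subset \<open>\<tau>\<close> of the Scarf set \<open>\<sigma>\<close>, then exchanging \<open>\<tau>\<close> for \<open>\<rho>\<close>
  inside \<open>\<sigma>\<close>, or \<open>\<rho>\<close> for \<open>\<tau>\<close>, would not change the lcm of \<open>\<sigma>\<close>. Since \<open>\<sigma>\<close> is determined by its lcm,
  both exchanges give back \<open>\<sigma>\<close>, which forces \<open>\<rho> = \<tau>\<close>.\<close>

lemma scarf_sets_subset_closed:
  assumes "finite G" "\<sigma> \<in> scarf_sets G" "\<tau> \<subseteq> \<sigma>"
  shows "\<tau> \<in> scarf_sets G"
proof -
  have \<sigma>: "\<sigma> \<subseteq> G" "\<And>\<rho>. \<rho> \<subseteq> G \<Longrightarrow> mlcm \<rho> = mlcm \<sigma> \<Longrightarrow> \<rho> = \<sigma>"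
    using assms(2) by (auto simp: scarf_sets_def)
  have "\<rho> = \<tau>" if \<rho>: "\<rho> \<subseteq> G" "mlcm \<rho> = mlcm \<tau>" for \<rho>
  proof -
    have fin: "finite \<rho>" "finite \<tau>" "finite \<sigma>"
      using finite_subset[OF \<rho>(1) assms(1)] finite_subset[OF \<sigma>(1) assms(1)]
        finite_subset[OF assms(3)] by auto
    have "mlcm (\<rho> \<union> (\<sigma> - \<tau>)) = mlcm (\<tau> \<union> (\<sigma> - \<tau>))"
      by (rule mlcm_Un_cong) (use fin \<rho>(2) in auto)
    also have "\<tau> \<union> (\<sigma> - \<tau>) = \<sigma>" using assms(3) by blast
    finally have 1: "\<rho> \<union> (\<sigma> - \<tau>) = \<sigma>" using \<sigma>(1) \<rho>(1) by (intro \<sigma>(2)) auto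
    have "mlcm (\<tau> \<union> (\<sigma> - \<rho>)) = mlcm (\<rho> \<union> (\<sigma> - \<rho>))"
      by (rule mlcm_Un_cong) (use fin \<rho>(2) in auto)
    also have "\<rho> \<union> (\<sigma> - \<rho>) = \<sigma>" using 1 by blast
    finally have "\<tau> \<union> (\<sigma> - \<rho>) = \<sigma>" using \<sigma>(1) assms(3) by (intro \<sigma>(2)) auto
    then show ?thesis using 1 assms(3) by blast
  qed
  then show ?thesis using \<sigma>(1) assms(3) by (auto simp: scarf_sets_def)
qed


section \<open>The Barile--Macchia matching\<close>

lemma finite_linear_order_has_least:
  assumes "linear_order_on G ord" "finite B" "B \<noteq> {}" "B \<subseteq> G"
  shows "\<exists>m\<in>B. \<forall>m'\<in>B. (m, m') \<in> ord"
  using assms(2-)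
proof (induction rule: finite_ne_induct)
  case (singleton x)
  then show ?case
    using assms(1) by (auto simp: order_on_defs refl_on_def)
next
  case (insert x B)
  then obtain m where m: "m \<in> B" "\<forall>m'\<in>B. (m, m') \<in> ord" by blast
  have ord: "trans ord" "total_on G ord" "(x, x) \<in> ord"
    using assms(1) insert.prems by (auto simp: order_on_defs refl_on_def)
  have "(x, m) \<in> ord \<or> (m, x) \<in> ord"
    using ord m(1) insert.prems by (metis insert_subset subsetD total_on_def)
  then show ?case using m ord by (metis insert_iff transD)
qed

text \<open>The pivot \<open>s\<close> is read off from the hull, so that it is the same for all sets with a given lcm. The
  bound on the cardinality is inherited from the initial state of the algorithm.\<close>

definition pivot_matching :: "'n::finite monomial set \<Rightarrow> 'n monomial rel \<Rightarrow> 'n monomial matching" where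
  "pivot_matching G ord =
     {(\<sigma>, \<sigma> - {s}) |\<sigma> s. \<sigma> \<subseteq> G \<and> 3 \<le> card \<sigma> \<and> s \<in> \<sigma> \<and> sb ord (lcm_hull G \<sigma>) = {s}}"

locale lcm_intersection_closed =
  fixes G :: "'n::finite monomial set" and ord :: "'n monomial rel"
  assumes finite_G: "finite G"
    and ord: "linear_order_on G ord"
    and lcm_Int: "\<And>\<sigma> \<tau>. \<sigma> \<subseteq> G \<Longrightarrow> \<tau> \<subseteq> G \<Longrightarrow> mlcm \<sigma> = mlcm \<tau> \<Longrightarrow> mlcm \<sigma> = mlcm (\<sigma> \<inter> \<tau>)"
begin

lemma finite_subset_G: "\<sigma> \<subseteq> G \<Longrightarrow> finite \<sigma>"
  using finite_G by (rule finite_subset[rotated])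

text \<open>The only direct use of closure under intersection: if \<open>m\<close> can be dropped from \<open>\<tau>\<close>, then
  \<open>\<sigma> \<inter> (\<tau> - {m})\<close> still has the common lcm, and \<open>\<sigma> - {m}\<close> lies between this set and \<open>\<sigma>\<close>.\<close>

lemma bridge_transfer:
  assumes "\<sigma> \<subseteq> G" "\<tau> \<subseteq> G" "mlcm \<sigma> = mlcm \<tau>" "m \<in> bridges \<tau>" "m \<in> \<sigma>"
  shows "m \<in> bridges \<sigma>"
proof -
  have lcm: "mlcm \<sigma> = mlcm (\<sigma> \<inter> (\<tau> - {m}))"
    by (rule lcm_Int) (use assms in \<open>auto simp: bridges_def\<close>)
  have "mlcm (\<sigma> - {m}) = mlcm \<sigma>"
    by (rule mlcm_sandwich[OF finite_subset_G[OF assms(1)] _ _ lcm[symmetric]]) auto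
  then show ?thesis using assms(5) by (simp add: bridges_def)
qed

lemma bridges_eq_hull:
  assumes "\<sigma> \<subseteq> G"
  shows "bridges \<sigma> = bridges (lcm_hull G \<sigma>) \<inter> \<sigma>"
proof
  have hull: "lcm_hull G \<sigma> \<subseteq> G" "\<sigma> \<subseteq> lcm_hull G \<sigma>" "mlcm (lcm_hull G \<sigma>) = mlcm \<sigma>"
    using lcm_hull_subset subset_lcm_hull[OF assms] mlcm_lcm_hull[OF finite_G assms] by blast+
  have "bridges \<sigma> \<subseteq> \<sigma>" by (auto simp: bridges_def)
  then show "bridges \<sigma> \<subseteq> bridges (lcm_hull G \<sigma>) \<inter> \<sigma>"
    using bridge_transfer[OF hull(1) assms hull(3)] hull(2) by blast
  show "bridges (lcm_hull G \<sigma>) \<inter> \<sigma> \<subseteq> bridges \<sigma>"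
    using bridge_transfer[OF assms hull(1) hull(3)[symmetric]] by blast
qed

lemma sb_singleton:
  assumes "\<sigma> \<subseteq> G" "bridges \<sigma> \<noteq> {}"
  obtains s where "sb ord \<sigma> = {s}"
proof -
  have sub: "bridges \<sigma> \<subseteq> G" using assms(1) by (auto simp: bridges_def)
  obtain s where "s \<in> bridges \<sigma>" "\<forall>m\<in>bridges \<sigma>. (s, m) \<in> ord"
    using finite_linear_order_has_least[OF ord finite_subset_G[OF sub] assms(2) sub] by blast
  moreover have "antisym ord" using ord by (simp add: order_on_defs)
  ultimately have "sb ord \<sigma> = {s}" unfolding sb_def antisym_def by blast
  then show ?thesis by (rule that)
qed

lemma sb_eq_pivot:
  assumes "\<sigma> \<subseteq> G" "sb ord (lcm_hull G \<sigma>) = {s}" "s \<in> \<sigma>"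
  shows "sb ord \<sigma> = {s}"
proof -
  have s: "s \<in> sb ord (lcm_hull G \<sigma>)" using assms(2) by simp
  then have "s \<in> sb ord \<sigma>"
    using bridges_eq_hull[OF assms(1)] assms(3) by (auto simp: sb_def)
  moreover from this have "bridges \<sigma> \<noteq> {}" by (auto simp: sb_def)
  then obtain s' where "sb ord \<sigma> = {s'}" by (rule sb_singleton[OF assms(1)])
  ultimately show ?thesis by simp
qed

text \<open>The pivot may be inserted because it belongs to the hull, and deleted because it is a bridge of
  the hull and therefore of every set in the class containing it.\<close>

lemma mlcm_toggle_pivot:
  assumes "\<sigma> \<subseteq> G" "sb ord (lcm_hull G \<sigma>) = {s}"
  shows "s \<in> G" "mlcm (insert s \<sigma>) = mlcm \<sigma>" "mlcm (\<sigma> - {s}) = mlcm \<sigma>"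
proof -
  have "s \<in> sb ord (lcm_hull G \<sigma>)" using assms(2) by simp
  then have s: "s \<in> lcm_hull G \<sigma>" "s \<in> bridges (lcm_hull G \<sigma>)"
    by (auto simp: sb_def bridges_def)
  show "s \<in> G" using s(1) lcm_hull_subset by blast
  have hull: "mlcm (lcm_hull G \<sigma>) = mlcm \<sigma>" "\<sigma> \<subseteq> lcm_hull G \<sigma>"
    using assms(1) finite_G by (auto simp: subset_lcm_hull mlcm_lcm_hull)
  have "mlcm (insert s \<sigma>) = mlcm (lcm_hull G \<sigma>)"
    by (rule mlcm_sandwich[OF finite_subset_G[OF lcm_hull_subset], of \<sigma>]) (use hull s(1) in auto)
  then show "mlcm (insert s \<sigma>) = mlcm \<sigma>" using hull(1) by simp
  show "mlcm (\<sigma> - {s}) = mlcm \<sigma>"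
  proof (cases "s \<in> \<sigma>")
    case True
    then have "s \<in> bridges \<sigma>" using s(2) bridges_eq_hull[OF assms(1)] by blast
    then show ?thesis by (simp add: bridges_def)
  qed simp
qed

lemma sb_hull_singleton:
  assumes "\<sigma> \<subseteq> G" "sb ord \<sigma> \<noteq> {}"
  obtains s where "sb ord (lcm_hull G \<sigma>) = {s}"
proof -
  have "bridges \<sigma> \<noteq> {}" using assms(2) by (auto simp: sb_def)
  then have "bridges (lcm_hull G \<sigma>) \<noteq> {}" using bridges_eq_hull[OF assms(1)] by blast
  then obtain s where "sb ord (lcm_hull G \<sigma>) = {s}" by (rule sb_singleton[OF lcm_hull_subset])
  then show ?thesis by (rule that)
qed

text \<open>An invariant of steps (1) and (2), for a state \<open>(\<Omega>, A)\<close>. The second conjunct guarantees that a set of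
  maximal cardinality in \<open>\<Omega>\<close> contains the pivot of its class, if there is one; the third one says
  that the pivot pairs missing from \<open>A\<close> still have their sources in \<open>\<Omega>\<close>. When \<open>\<Omega>\<close> has been
  exhausted, \<open>A\<close> is the pivot matching.\<close>

definition run_invariant :: "'n monomial set set \<times> 'n monomial matching \<Rightarrow> bool" where
  "run_invariant = (\<lambda>(\<Omega>, A).
     \<Omega> \<subseteq> {\<sigma>. \<sigma> \<subseteq> G \<and> 3 \<le> card \<sigma>} \<and>
     (\<forall>\<sigma>\<in>\<Omega>. \<forall>s. sb ord (lcm_hull G \<sigma>) = {s} \<longrightarrow> insert s \<sigma> \<in> \<Omega>) \<and>
     A \<union> {e \<in> pivot_matching G ord. fst e \<in> \<Omega>} = pivot_matching G ord)"

lemma run_invariant_start: "run_invariant (bm_start G)"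
proof -
  have "insert s \<sigma> \<subseteq> G \<and> 3 \<le> card (insert s \<sigma>)"
    if "\<sigma> \<subseteq> G" "3 \<le> card \<sigma>" "sb ord (lcm_hull G \<sigma>) = {s}" for \<sigma> s
    using that mlcm_toggle_pivot[OF that(1,3)] card_insert_le[of \<sigma> s] by auto
  then show ?thesis by (auto simp: run_invariant_def bm_start_def pivot_matching_def)
qed

text \<open>A chosen set without bridges is neither a source of the pivot matching nor of the form
  \<open>insert s \<tau>\<close> with \<open>s\<close> the pivot of \<open>\<tau>\<close>, so discarding it is harmless. A chosen set with a bridge
  contains its pivot by maximality; its pivot is then its smallest bridge, and the two sets
  discarded are one pivot pair, which is disjoint from all the others.\<close>

lemma run_invariant_step:
  assumes "bm_step ord X Y" "run_invariant X"
  shows "run_invariant Y"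
  using assms(1)
proof cases
  case (1 \<sigma> \<Omega> A)
  let ?P = "pivot_matching G ord"
  have \<Omega>': "\<Omega> \<subseteq> {\<sigma>. \<sigma> \<subseteq> G \<and> 3 \<le> card \<sigma>}"
    and closed: "\<And>\<tau> s. \<tau> \<in> \<Omega> \<Longrightarrow> sb ord (lcm_hull G \<tau>) = {s} \<Longrightarrow> insert s \<tau> \<in> \<Omega>"
    and A: "A \<union> {e \<in> ?P. fst e \<in> \<Omega>} = ?P"
    using assms(2) 1(1) by (simp_all add: run_invariant_def)
  have \<Omega>: "\<tau> \<subseteq> G \<and> 3 \<le> card \<tau>" if "\<tau> \<in> \<Omega>" for \<tau>
    using \<Omega>' that by blast
  have \<sigma>: "\<sigma> \<subseteq> G" "3 \<le> card \<sigma>" using \<Omega> 1(3) by auto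
  have fin: "finite \<sigma>" using \<sigma>(1) finite_subset_G by blast
  show ?thesis
  proof (cases "sb ord \<sigma> = {}")
    case True
    have no_edge: "\<sigma> \<noteq> fst e" if "e \<in> ?P" for e
      using that True sb_eq_pivot by (fastforce simp: pivot_matching_def)
    have "insert s \<tau> \<noteq> \<sigma>" if "\<tau> \<in> \<Omega>" "sb ord (lcm_hull G \<tau>) = {s}" for \<tau> s
    proof
      assume eq: "insert s \<tau> = \<sigma>"
      have "\<tau> \<subseteq> G" using that(1) \<Omega> by blast
      then have "mlcm \<tau> = mlcm \<sigma>" using mlcm_toggle_pivot[of \<tau> s] that(2) eq by simp
      then have "sb ord \<sigma> = {s}"
        using sb_eq_pivot[OF \<sigma>(1)] that(2) eq lcm_hull_cong[of \<tau> \<sigma> G] by auto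
      then show False using True by simp
    qed
    moreover have "{e \<in> ?P. fst e \<in> \<Omega> - {\<sigma>}} = {e \<in> ?P. fst e \<in> \<Omega>}" using no_edge by auto
    ultimately show ?thesis
      unfolding 1(2) run_invariant_def using True \<Omega>' closed A by auto
  next
    case False
    obtain s where s: "sb ord (lcm_hull G \<sigma>) = {s}" using sb_hull_singleton[OF \<sigma>(1) False] .
    have "s \<in> \<sigma>"
    proof (rule ccontr)
      assume "s \<notin> \<sigma>"
      then have "card \<sigma> < card (insert s \<sigma>)" using fin by simp
      then show False using closed[OF 1(3) s] 1(4) by (meson leD)
    qed
    then have sb: "sb ord \<sigma> = {s}" using sb_eq_pivot[OF \<sigma>(1) s] by simp
    have lcm: "mlcm (\<sigma> - {s}) = mlcm \<sigma>" using mlcm_toggle_pivot[OF \<sigma>(1) s] by simp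
    have edge: "(\<sigma>, \<sigma> - {s}) \<in> ?P"
      using \<sigma> s \<open>s \<in> \<sigma>\<close> by (auto simp: pivot_matching_def)
    have not_source: "fst e \<noteq> \<sigma> - {s}" if "e \<in> ?P" for e
      using that s lcm_hull_cong[OF lcm, of G] by (auto simp: pivot_matching_def)
    have unique: "e = (\<sigma>, \<sigma> - {s})" if "e \<in> ?P" "fst e = \<sigma>" for e
      using that s by (auto simp: pivot_matching_def)
    have "insert s' \<tau> \<notin> {\<sigma>, \<sigma> - {s}}"
      if "\<tau> \<in> \<Omega> - {\<sigma>, \<sigma> - {s}}" "sb ord (lcm_hull G \<tau>) = {s'}" for \<tau> s'
    proof
      assume eq: "insert s' \<tau> \<in> {\<sigma>, \<sigma> - {s}}"
      have "\<tau> \<subseteq> G" using that(1) \<Omega> by blast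
      then have "mlcm \<tau> = mlcm \<sigma>"
        using mlcm_toggle_pivot[of \<tau> s'] that(2) eq lcm by auto
      then have "s' = s" using that(2) s lcm_hull_cong[of \<tau> \<sigma> G] by auto
      then show False using eq that(1) by auto
    qed
    then have "\<forall>\<tau>\<in>\<Omega> - {\<sigma>, \<sigma> - {s}}. \<forall>s'. sb ord (lcm_hull G \<tau>) = {s'} \<longrightarrow>
        insert s' \<tau> \<in> \<Omega> - {\<sigma>, \<sigma> - {s}}"
      using closed by blast
    moreover have "insert (\<sigma>, \<sigma> - {s}) A \<union> {e \<in> ?P. fst e \<in> \<Omega> - {\<sigma>, \<sigma> - {s}}} = ?P"
      using A edge not_source unique by blast
    ultimately show ?thesis
      unfolding 1(2) sb run_invariant_def using \<Omega>' by auto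
  qed
qed

lemma bm_candidates_eq: "bm_candidates G ord = pivot_matching G ord"
proof -
  have "(bm_step ord)\<^sup>*\<^sup>* (bm_start G) ({}, bm_candidates G ord)"
    unfolding bm_candidates_def by (rule theI'[OF bm_candidates_unique[OF finite_G]])
  then have "run_invariant ({}, bm_candidates G ord)"
    by (induction rule: rtranclp_induct) (auto intro: run_invariant_start run_invariant_step)
  then show ?thesis by (simp add: run_invariant_def)
qed

lemma pivot_matching_edge:
  assumes "(\<sigma>, \<tau>) \<in> pivot_matching G ord"
  obtains s where "\<sigma> \<subseteq> G" "\<tau> \<subseteq> G" "s \<notin> \<tau>" "\<sigma> = insert s \<tau>" "mlcm \<tau> = mlcm \<sigma>"
    "sb ord (lcm_hull G \<sigma>) = {s}" "sb ord (lcm_hull G \<tau>) = {s}"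
proof -
  obtain s where s: "\<sigma> \<subseteq> G" "s \<in> \<sigma>" "\<tau> = \<sigma> - {s}" "sb ord (lcm_hull G \<sigma>) = {s}"
    using assms by (auto simp: pivot_matching_def)
  moreover have "mlcm \<tau> = mlcm \<sigma>" using mlcm_toggle_pivot(3)[OF s(1,4)] s(3) by simp
  moreover from this have "sb ord (lcm_hull G \<tau>) = {s}"
    using s(4) lcm_hull_cong[of \<tau> \<sigma> G] by simp
  ultimately show ?thesis using that[of s] by blast
qed

text \<open>A source is recovered from its target by inserting the pivot, which the target determines. So no
  two candidates compete for a target.\<close>

lemma bm_matching_eq: "bm_matching G ord = pivot_matching G ord"
proof -
  have "\<sigma> = \<sigma>'" if "(\<sigma>, \<tau>) \<in> pivot_matching G ord" "(\<sigma>', \<tau>) \<in> pivot_matching G ord" for \<sigma> \<sigma>' \<tau>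
    using that by (elim pivot_matching_edge) auto
  then show ?thesis unfolding bm_matching_def bm_candidates_eq by blast
qed

lemma pivot_matching_subset_graph: "pivot_matching G ord \<subseteq> subset_graph G"
proof
  fix e assume "e \<in> pivot_matching G ord"
  then obtain \<sigma> \<tau> where e: "e = (\<sigma>, \<tau>)" "(\<sigma>, \<tau>) \<in> pivot_matching G ord" by (cases e) auto
  from e(2) obtain s where s: "\<sigma> \<subseteq> G" "s \<notin> \<tau>" "\<sigma> = insert s \<tau>"
    by (rule pivot_matching_edge)
  then have "finite \<tau>" using finite_subset_G[of \<sigma>] by simp
  then show "e \<in> subset_graph G"
    using s e(1) by (auto simp: subset_graph_def facets_def)
qed

lemma pivot_matching_disjoint:
  "Domain (pivot_matching G ord) \<inter> Range (pivot_matching G ord) = {}"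
proof -
  have False if "(\<sigma>, \<tau>) \<in> pivot_matching G ord" "(\<rho>, \<sigma>) \<in> pivot_matching G ord" for \<sigma> \<tau> \<rho>
    using that by (elim pivot_matching_edge) auto
  then show ?thesis by blast
qed

text \<open>A set sharing its lcm with another one has a pivot \<open>s\<close>, as any element in which the two sets differ
  is a bridge of the hull. It then lies in the pivot pair with source \<open>\<rho> = insert s \<sigma>\<close>, provided that
  \<open>\<rho>\<close> has at least three elements. Otherwise \<open>\<rho> - {s}\<close> is empty or a singleton, so the bridge \<open>s\<close>
  would be \<open>1\<close> or would divide another generator.\<close>

lemma critical_sets_eq_scarf:
  assumes antichain: "\<And>a b t. a \<in> G \<Longrightarrow> b \<in> G \<Longrightarrow> b = a + t \<Longrightarrow> a = b"
    and "0 \<notin> G"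
  shows "critical_sets G (pivot_matching G ord) = scarf_sets G"
proof
  show "scarf_sets G \<subseteq> critical_sets G (pivot_matching G ord)"
  proof
    fix \<sigma> assume \<sigma>: "\<sigma> \<in> scarf_sets G"
    have "\<sigma> \<notin> Field (pivot_matching G ord)"
    proof
      assume "\<sigma> \<in> Field (pivot_matching G ord)"
      then obtain \<tau> where "(\<sigma>, \<tau>) \<in> pivot_matching G ord \<or> (\<tau>, \<sigma>) \<in> pivot_matching G ord"
        by (auto simp: Field_def)
      then have "\<tau> \<subseteq> G \<and> \<tau> \<noteq> \<sigma> \<and> mlcm \<tau> = mlcm \<sigma>"
        by (auto elim!: pivot_matching_edge)
      then show False using \<sigma> by (auto simp: scarf_sets_def)
    qed
    then show "\<sigma> \<in> critical_sets G (pivot_matching G ord)"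
      using \<sigma> by (auto simp: critical_sets_def scarf_sets_def)
  qed
next
  show "critical_sets G (pivot_matching G ord) \<subseteq> scarf_sets G"
  proof (rule subsetI, rule ccontr)
    fix \<sigma> assume crit: "\<sigma> \<in> critical_sets G (pivot_matching G ord)" and "\<sigma> \<notin> scarf_sets G"
    then obtain \<tau> where \<tau>: "\<tau> \<subseteq> G" "\<tau> \<noteq> \<sigma>" "mlcm \<tau> = mlcm \<sigma>" and \<sigma>: "\<sigma> \<subseteq> G"
      by (auto simp: critical_sets_def scarf_sets_def)
    let ?H = "lcm_hull G \<sigma>"
    have H: "?H \<subseteq> G" "finite ?H" "mlcm ?H = mlcm \<sigma>" "\<sigma> \<subseteq> ?H" "\<tau> \<subseteq> ?H"
      using \<sigma> \<tau> finite_G lcm_hull_subset[of G \<sigma>] finite_subset_G[of ?H]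
        subset_lcm_hull[OF \<sigma>] subset_lcm_hull[OF \<tau>(1)] lcm_hull_cong[OF \<tau>(3), of G]
      by (auto simp: mlcm_lcm_hull)
    have bridge: "m \<in> bridges ?H" if "m \<in> ?H" "m \<notin> \<rho>" "\<rho> \<subseteq> ?H" "mlcm \<rho> = mlcm \<sigma>" for m \<rho>
      using that H mlcm_sandwich[of ?H \<rho> "?H - {m}"] by (auto simp: bridges_def)
    obtain m where "m \<in> \<sigma> - \<tau> \<or> m \<in> \<tau> - \<sigma>" using \<tau>(2) by blast
    then have "m \<in> bridges ?H" using bridge[of m \<sigma>] bridge[of m \<tau>] H \<tau>(3) by blast
    then obtain s where s: "sb ord ?H = {s}" using sb_singleton[OF H(1)] by blast
    define \<rho> where "\<rho> = insert s \<sigma>"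
    have \<rho>: "\<rho> \<subseteq> G" "mlcm \<rho> = mlcm \<sigma>" "finite \<rho>" "s \<in> \<rho>" "s \<in> G"
      using mlcm_toggle_pivot[OF \<sigma> s] \<sigma> finite_subset_G[OF \<sigma>] by (auto simp: \<rho>_def)
    have s\<rho>: "sb ord (lcm_hull G \<rho>) = {s}" using s lcm_hull_cong[OF \<rho>(2), of G] by simp
    have lcm: "mlcm (\<rho> - {s}) = mlcm \<rho>" using mlcm_toggle_pivot(3)[OF \<rho>(1) s\<rho>] .
    have le: "Poly_Mapping.lookup s i \<le> Poly_Mapping.lookup (mlcm (\<rho> - {s})) i" for i
      unfolding lcm using \<rho>(3,4) by (rule lookup_le_mlcm)
    have "3 \<le> card \<rho>"
    proof (rule ccontr)
      assume "\<not> 3 \<le> card \<rho>"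
      then have "card (\<rho> - {s}) = 0 \<or> card (\<rho> - {s}) = 1" using \<rho>(3,4) by auto
      then consider "\<rho> - {s} = {}" | b where "\<rho> - {s} = {b}"
        using \<rho>(3) by (metis card_0_eq card_1_singletonE finite_Diff)
      then show False
      proof cases
        case 1
        then have "s = 0" using le unfolding 1 mlcm_empty by (intro poly_mapping_eqI) simp
        then show False using assms(2) \<rho>(5) by simp
      next
        case (2 b)
        have "Poly_Mapping.lookup (mlcm {b}) i = Poly_Mapping.lookup b i" for i
          by (simp add: lookup_mlcm)
        then have "\<exists>t. b = s + t" using le unfolding 2 monomial_dvd_iff by simp
        then have "s = b" using antichain \<rho>(1,5) 2 by blast
        then show False using 2 by blast
      qed
    qed
    then have "(\<rho>, \<rho> - {s}) \<in> pivot_matching G ord"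
      using \<rho> s\<rho> by (auto simp: pivot_matching_def)
    moreover have "\<sigma> = \<rho> \<or> \<sigma> = \<rho> - {s}" by (auto simp: \<rho>_def)
    ultimately have "\<sigma> \<in> Field (pivot_matching G ord)" by (auto simp: Field_def)
    then show False using crit by (simp add: critical_sets_def)
  qed
qed

end


section \<open>The induced complex\<close>

text \<open>A path can rise only along a reversed edge of \<open>A\<close>, which ends in a source of \<open>A\<close>, and a source is
  not a target, so the next step falls. As the path starts in a critical set, it can therefore never
  climb above the initial cardinality. But the last edge of a nontrivial path ends in a critical set,
  hence is not reversed and comes from one level above the end point, that is, above the start.\<close>

lemma gradient_paths_between_critical:
  assumes A: "A \<subseteq> subset_graph G" "Domain A \<inter> Range A = {}"
    and crit: "\<sigma> \<in> critical_sets G A" "\<tau> \<in> critical_sets G A" and card: "card \<sigma> = card \<tau>"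
  shows "gradient_paths G A \<sigma> \<tau> = (if \<sigma> = \<tau> then {[\<sigma>]} else {})"
proof -
  have down: "Suc (card b) = card a" if "(a, b) \<in> subset_graph G" for a b
    using that by (auto simp: subset_graph_def facets_def)
  have not_field: "\<sigma> \<notin> Field A" "\<tau> \<notin> Field A" using crit by (auto simp: critical_sets_def)
  have "p = [\<sigma>] \<and> \<sigma> = \<tau>" if "p \<in> gradient_paths G A \<sigma> \<tau>" for p
  proof -
    have p: "p \<noteq> []" "hd p = \<sigma>" "last p = \<tau>"
      and edges: "\<And>i. Suc i < length p \<Longrightarrow> (p ! i, p ! Suc i) \<in> reversed_graph G A"
      using that by (auto simp: gradient_paths_def successively_conv_nth)
    \<comment> \<open>The second conjunct says that no rising edge leaves the top level.\<close>
    have level: "card (p ! i) \<le> card \<sigma> \<and> (card (p ! i) = card \<sigma> \<longrightarrow> p ! i \<notin> Range A)"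
      if "i < length p" for i
      using that
    proof (induction i)
      case 0
      then show ?case using p not_field by (auto simp: hd_conv_nth[symmetric] Field_def)
    next
      case (Suc i)
      from edges[OF Suc.prems] consider "(p ! i, p ! Suc i) \<in> subset_graph G"
        | "(p ! Suc i, p ! i) \<in> A"
        by (auto simp: reversed_graph_def)
      then show ?case
      proof cases
        case 1
        then show ?thesis using down[OF 1] Suc by auto
      next
        case 2
        then have "Suc (card (p ! i)) = card (p ! Suc i)" using down A(1) by blast
        moreover have "card (p ! i) < card \<sigma>" using Suc 2 by (force simp: order_less_le)
        ultimately show ?thesis using 2 A(2) by auto
      qed
    qed
    have "length p = 1"
    proof (rule ccontr)
      assume "length p \<noteq> 1"
      then obtain n where n: "length p = Suc (Suc n)"
        using p(1) by (metis One_nat_def length_0_conv not0_implies_Suc)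
      then have last: "p ! Suc n = \<tau>" using p by (simp add: last_conv_nth)
      have "(p ! n, \<tau>) \<in> reversed_graph G A" using edges[of n] n last by simp
      then have "(p ! n, \<tau>) \<in> subset_graph G"
        using not_field by (auto simp: reversed_graph_def Field_def)
      then show False using down level[of n] n card by force
    qed
    then show ?thesis using p by (cases p) auto
  qed
  moreover have "[\<sigma>] \<in> gradient_paths G A \<sigma> \<sigma>"
    using crit(1) by (auto simp: gradient_paths_def critical_sets_def)
  ultimately show ?thesis by auto
qed

text \<open>In the sum over gradient paths only the trivial path at each facet survives, and its weight is an
  empty product.\<close>

lemma morse_boundary_eq_taylor:
  assumes "finite G" "A \<subseteq> subset_graph G" "Domain A \<inter> Range A = {}"
    and facets: "facets \<sigma> \<subseteq> critical_sets G A"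
  shows "(morse_boundary G ord A \<sigma> :: _ \<Rightarrow>\<^sub>0 ('n::finite, 'k::field) mpoly) = taylor_boundary ord \<sigma>"
  unfolding morse_boundary_def taylor_boundary_def
proof (rule sum.cong[OF refl])
  fix \<sigma>' assume \<sigma>': "\<sigma>' \<in> facets \<sigma>"
  let ?S = "{\<sigma>''. \<sigma>'' \<in> critical_sets G A \<and> Suc (card \<sigma>'') = card \<sigma>}"
  let ?term = "\<lambda>\<sigma>''. Poly_Mapping.single \<sigma>''
      (of_int (boundary_sign ord \<sigma> \<sigma>') * monom (mlcm \<sigma> - mlcm \<sigma>'') :: ('n, 'k) mpoly)"
  have card: "Suc (card \<sigma>') = card \<sigma>" using \<sigma>' by (simp add: facets_def)
  have crit: "\<sigma>' \<in> critical_sets G A" using \<sigma>' facets by blast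
  have fin: "finite ?S"
    by (rule finite_subset[of _ "Pow G"]) (auto simp: critical_sets_def assms(1))
  have "(\<Sum>\<sigma>''\<in>?S. \<Sum>p\<in>gradient_paths G A \<sigma>' \<sigma>''. Poly_Mapping.single \<sigma>''
            (of_int (boundary_sign ord \<sigma> \<sigma>' * path_weight ord A p) * monom (mlcm \<sigma> - mlcm \<sigma>'')))
      = (\<Sum>\<sigma>''\<in>?S. if \<sigma>' = \<sigma>'' then ?term \<sigma>'' else 0)"
  proof (rule sum.cong[OF refl])
    fix \<sigma>'' assume "\<sigma>'' \<in> ?S"
    then have paths: "gradient_paths G A \<sigma>' \<sigma>'' = (if \<sigma>' = \<sigma>'' then {[\<sigma>']} else {})"
      using card crit assms(2,3) by (intro gradient_paths_between_critical) auto
    show "(\<Sum>p\<in>gradient_paths G A \<sigma>' \<sigma>''. Poly_Mapping.single \<sigma>''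
            (of_int (boundary_sign ord \<sigma> \<sigma>' * path_weight ord A p) * monom (mlcm \<sigma> - mlcm \<sigma>'')))
        = (if \<sigma>' = \<sigma>'' then ?term \<sigma>'' else 0)"
      unfolding paths by (simp add: path_weight_def)
  qed
  also have "\<dots> = ?term \<sigma>'"
    using fin card crit by (simp add: sum.delta')
  finally show "(\<Sum>\<sigma>''\<in>?S. \<Sum>p\<in>gradient_paths G A \<sigma>' \<sigma>''. Poly_Mapping.single \<sigma>''
            (of_int (boundary_sign ord \<sigma> \<sigma>' * path_weight ord A p) * monom (mlcm \<sigma> - mlcm \<sigma>'')))
      = ?term \<sigma>'" .
qed

lemma linear_extension_cong:
  assumes "\<And>b. b \<in> Poly_Mapping.keys f \<Longrightarrow> \<phi> b = \<psi> b"
  shows "linear_extension \<phi> f = linear_extension \<psi> f"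
  unfolding linear_extension_def using assms by (intro sum.cong) auto

lemma spanned_subcomplex_complex_on_cells:
  assumes "X \<subseteq> Y" "\<And>\<sigma>. \<sigma> \<in> X \<Longrightarrow> \<phi> \<sigma> = \<psi> \<sigma>"
  shows "spanned_subcomplex (complex_on_cells Y \<psi>) X = complex_on_cells X \<phi>"
proof -
  have chains: "free_on {\<sigma> \<in> Y. card \<sigma> = r} \<inter> free_on X = free_on {\<sigma> \<in> X. card \<sigma> = r}" for r
    using assms(1) by (auto simp: free_on_def)
  have "restrict (restrict (linear_extension \<psi>) (free_on {\<sigma> \<in> Y. card \<sigma> = r}))
      (free_on {\<sigma> \<in> X. card \<sigma> = r}) = restrict (linear_extension \<phi>) (free_on {\<sigma> \<in> X. card \<sigma> = r})" for r
  proof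
    fix f
    have "linear_extension \<psi> f = linear_extension \<phi> f" if "f \<in> free_on {\<sigma> \<in> X. card \<sigma> = r}"
      using that assms(2) by (intro linear_extension_cong) (auto simp: free_on_def)
    then show "restrict (restrict (linear_extension \<psi>) (free_on {\<sigma> \<in> Y. card \<sigma> = r}))
      (free_on {\<sigma> \<in> X. card \<sigma> = r}) f =
      restrict (linear_extension \<phi>) (free_on {\<sigma> \<in> X. card \<sigma> = r}) f"
      using chains[of r] by auto
  qed
  then show ?thesis by (simp add: spanned_subcomplex_def complex_on_cells_def Let_def chains)
qed

theorem theorem5p3:
  fixes I :: "('n::finite, 'k::field) mpoly set"
  assumes "monomial_ideal I"
    and "\<And>\<sigma> \<tau>. \<sigma> \<subseteq> min_gens I \<Longrightarrow> \<tau> \<subseteq> min_gens I \<Longrightarrow> mlcm \<sigma> = mlcm \<tau> \<Longrightarrow>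
           mlcm \<sigma> = mlcm (\<sigma> \<inter> \<tau>)"
  shows "bridge_friendly I \<and>
    (I \<noteq> UNIV \<longrightarrow>
      (\<forall>ord. bridge_friendly_wrt I ord \<longrightarrow>
         barile_macchia_resolution I ord = scarf_complex I ord))"
proof (intro conjI impI allI)
  let ?G = "min_gens I"
  obtain ord where "well_order_on ?G ord" using well_order_on by blast
  then have lin: "linear_order_on ?G ord" by (simp add: well_order_on_def)
  interpret lcm_intersection_closed ?G ord
    using finite_min_gens[OF assms(1)] lin assms(2) by unfold_locales
  have "bridge_friendly_wrt I ord"
    using lin by (simp add: bridge_friendly_wrt_def potentially_type_2_def type_2_def
        bm_candidates_eq bm_matching_eq)
  then show "bridge_friendly I" unfolding bridge_friendly_def ..
next
  let ?G = "min_gens I"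
  fix ord assume "I \<noteq> UNIV" "bridge_friendly_wrt I ord"
  then have lin: "linear_order_on ?G ord" by (simp add: bridge_friendly_wrt_def)
  interpret lcm_intersection_closed ?G ord
    using finite_min_gens[OF assms(1)] lin assms(2) by unfold_locales
  let ?P = "pivot_matching ?G ord"
  have crit: "critical_sets ?G ?P = scarf_sets ?G"
    using min_gens_antichain[OF assms(1)] one_in_min_gens_imp_UNIV[OF assms(1)] \<open>I \<noteq> UNIV\<close>
    by (intro critical_sets_eq_scarf) auto
  have "morse_boundary ?G ord ?P \<sigma> = (taylor_boundary ord \<sigma> :: _ \<Rightarrow>\<^sub>0 ('n, 'k) mpoly)"
    if "\<sigma> \<in> scarf_sets ?G" for \<sigma>
    using scarf_sets_subset_closed[OF finite_G that]
    by (intro morse_boundary_eq_taylor finite_G pivot_matching_subset_graph pivot_matching_disjoint)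
       (auto simp: crit facets_def)
  then show "barile_macchia_resolution I ord = scarf_complex I ord"
    unfolding barile_macchia_resolution_def morse_complex_def scarf_complex_def
      taylor_resolution_def bm_matching_eq crit
    by (intro spanned_subcomplex_complex_on_cells[symmetric]) (auto simp: scarf_sets_def)
qed

end
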